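(* Let $n$ and $h$ be integers with $n\ge 9$ and $\left\lceil\frac{11\times 2^{n-1}}{48}\right\rceil\le h\le 2^{n-1}$. Then: (a) $\lambda_h(Q_{n,2})=\xi_{2^{n-1}}(Q_{n,2})=2^{n-1}$; (b) $Q_{n,2}$ is $\lambda_h$-optimal, i.e. $\lambda_h(Q_{n,2})=\xi_h(Q_{n,2})=2^{n-1}$, if and only if $h=m_{n,r}$ for some integer $r$ with $1\le r\le \lceil\frac n2\rceil-1$.
   Context: The $(n,2)$-enhanced hypercube $Q_{n,2}$ is the graph whose vertices are all binary strings $x_nx_{n-1}\cdots x_1$ with $x_i\in\{0,1\}$. Two vertices $x=x_n\cdots x_1$ and $y$ are adjacent iff either $y$ differs from $x$ in exactly one position, or $y=x_n\bar x_{n-1}\bar x_{n-2}\cdots\bar x_1$, where $\bar x_i=1-x_i$. (It is $(n+1)$-regular with $2^n$ vertices.) For a connected graph $G$ and a positive integer $h$, an $h$-extra edge-cut is a set of edges of $G$ whose deletion yields a disconnected graph all of whose components have at least $h$ vertices. The $h$-extra edge-connectivity $\lambda_h(G)$ is the minimum cardinality of an $h$-extra edge-cut of $G$. For $X\subset V(G)$, $\overline X=V(G)\setminus X$, $G[X]$ is the subgraph induced by $X$, and $[X,\overline X]_G$ is the set of edges of $G$ with one end in $X$ and the other in $\overline X$. For $1\le m\le\lfloor |V(G)|/2\rfloor$, $$\xi_m(G)=\min\{|[X,\overline X]_G| : |X|=m,\ \text{both } G[X] \text{ and } G[\overline X] \text{ are connected}\}.$$ $G$ is called $\lambda_h$-optimal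 if $\lambda_h(G)=\xi_h(G)$. Let $f=0$ if $n$ is even and $f=1$ if $n$ is odd. For $n\ge 9$ and $r=1,2,\dots,\lceil\frac n2\rceil-1$ define $$m_{n,r}=\begin{cases}\sum_{i=0}^{2}2^{n-4-i}+\sum_{i=0}^{\lceil n/2\rceil-4-r}2^{n-8-2i}+2^{2r-1-f} & \text{if } 1\le r\le\lceil\frac n2\rceil-4,\\ \sum_{i=0}^{3}2^{n-4-i} & \text{if } r=\lceil\frac n2\rceil-3,\\ 2^{n-3} & \text{if } r=\lceil\frac n2\rceil-2,\\ 2^{n-1} & \text{if } r=\lceil\frac n2\rceil-1.\end{cases}$$ *)

theory Defs
  imports Complex_Main "HOL-Library.Extended_Nat"
begin

(* A simple graph is a pair (V, E) whose edges are two-element vertex sets {u, v},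
   so that card counts every undirected edge once. *)
type_synonym 'a graph = "'a set \<times> 'a set set"

abbreviation verts :: "'a graph \<Rightarrow> 'a set" where
  "verts G \<equiv> fst G"

abbreviation edges :: "'a graph \<Rightarrow> 'a set set" where
  "edges G \<equiv> snd G"

definition adj_rel :: "'a graph \<Rightarrow> ('a \<times> 'a) set" where
  "adj_rel G = {(u, v). u \<in> verts G \<and> v \<in> verts G \<and> {u, v} \<in> edges G}"

definition joined_rel :: "'a graph \<Rightarrow> ('a \<times> 'a) set" where
  "joined_rel G = {(u, v). u \<in> verts G \<and> v \<in> verts G \<and> (u, v) \<in> (adj_rel G)\<^sup>*}"

definition connected_graph :: "'a graph \<Rightarrow> bool" where
  "connected_graph G \<longleftrightarrow>
     verts G \<noteq> {} \<and> (\<forall>u\<in>verts G. \<forall>v\<in>verts G. (u, v) \<in> joined_rel G)"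

(* The components are represented by their vertex sets. *)
definition components_of :: "'a graph \<Rightarrow> 'a set set" where
  "components_of G = verts G // joined_rel G"

definition delete_edges :: "'a graph \<Rightarrow> 'a set set \<Rightarrow> 'a graph" where
  "delete_edges G F = (verts G, edges G - F)"

definition induced :: "'a graph \<Rightarrow> 'a set \<Rightarrow> 'a graph" where
  "induced G X = (X, {e \<in> edges G. e \<subseteq> X})"

definition edges_between :: "'a graph \<Rightarrow> 'a set \<Rightarrow> 'a set \<Rightarrow> 'a set set" where
  "edges_between G X Y = {e \<in> edges G. \<exists>x\<in>X. \<exists>y\<in>Y. e = {x, y}}"

definition extra_edge_cut :: "nat \<Rightarrow> 'a graph \<Rightarrow> 'a set set \<Rightarrow> bool" where
  "extra_edge_cut h G F \<longleftrightarrow>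
     F \<subseteq> edges G \<and> \<not> connected_graph (delete_edges G F) \<and>
     (\<forall>C\<in>components_of (delete_edges G F). h \<le> card C)"

(* In enat the next two infima are minima whenever the set is non-empty, and are \<infinity>
   if there is no h-extra edge-cut, respectively no admissible X. *)
definition extra_edge_conn :: "nat \<Rightarrow> 'a graph \<Rightarrow> enat" where
  "extra_edge_conn h G = Inf {enat (card F) | F. extra_edge_cut h G F}"

definition xi :: "nat \<Rightarrow> 'a graph \<Rightarrow> enat" where
  "xi m G = Inf {enat (card (edges_between G X (verts G - X))) | X.
     X \<subseteq> verts G \<and> card X = m \<and>
     connected_graph (induced G X) \<and> connected_graph (induced G (verts G - X))}"

definition extra_optimal :: "nat \<Rightarrow> 'a graph \<Rightarrow> bool" where
  "extra_optimal h G \<longleftrightarrow> extra_edge_conn h G = xi h G"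

(* The string x_n x_(n-1) ... x_1 is the list [x_n, x_(n-1), ..., x_1] (True for 1):
   the head is x_n, so complementing x_(n-1), ..., x_1 complements the tail. *)
definition enh_adj :: "bool list \<Rightarrow> bool list \<Rightarrow> bool" where
  "enh_adj x y \<longleftrightarrow>
     card {i. i < length x \<and> x ! i \<noteq> y ! i} = 1 \<or> y = hd x # map Not (tl x)"

definition enhanced_hypercube :: "nat \<Rightarrow> bool list graph" where
  "enhanced_hypercube n =
     ({x. length x = n},
      {{x, y} | x y. length x = n \<and> length y = n \<and> enh_adj x y})"

(* Only used for n \<ge> 9 and 1 \<le> r \<le> c - 1, where no subtraction below truncates;
   the last branch is then the case r = c - 1. *)
definition m_val :: "nat \<Rightarrow> nat \<Rightarrow> nat" where
  "m_val n r =
     (let c = nat \<lceil>real n / 2\<rceil>; f = (if even n then 0 else 1) in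
      if r \<le> c - 4 then
        (\<Sum>i = 0..2. 2 ^ (n - 4 - i)) + (\<Sum>i = 0..c - 4 - r. 2 ^ (n - 8 - 2 * i))
          + 2 ^ (2 * r - 1 - f)
      else if r = c - 3 then (\<Sum>i = 0..3. 2 ^ (n - 4 - i))
      else if r = c - 2 then 2 ^ (n - 3)
      else 2 ^ (n - 1))"

end

(* Split Q_(n,2) along x_n: it is the prism over the folded hypercube FQ_k, k = n - 1, so a set X
   of m vertices with slices of a and b vertices has at most e(a) + e(b) + min a b inner edges,
   e being the maximal edge number in FQ_k. For the ordinary cube the maximum is attained by
   initial segments in binary order, and its value cube_edges is superadditive with surplus
   min a b. For FQ_k the same value, plus a - 2^(k-1) beyond half of the vertices, is an upper bound: in FQ_k two
   generators leave each of the two half cubes, and the extra edges they produce are paid for by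
   antipodal pairs inside the halves, which the induction hypothesis counts against them.
   The graph is (k + 2)-regular, so the claim becomes an inequality for (k + 2) m - 2 cube_edges m.
   For m < 2^(k-2) put t = 2^(k-2) - m; complementing in the cube of dimension k - 2 turns it into
   2 cube_edges t <= (k - 6) t for 3 t <= 4 * 2^(k-6), and stripping the leading power of two of t
   reproduces this condition with k - 6 replaced by k - 8. Hence the equality cases
   t = 2^(k-6) + 2^(k-8) + ...; initial segments attain them. *)
theory Submission
  imports Defs
begin

subsection \<open>Edges of initial segments of the cube\<close>

text \<open>The number of edges spanned by the first \<open>m\<close> vertices of a hypercube in binary order;
  the even and the odd ones among them lie in two facets.\<close>

fun cube_edges :: "nat \<Rightarrow> nat" where
  "cube_edges m = (if m \<le> 1 then 0
     else cube_edges (m div 2) + cube_edges ((m + 1) div 2) + m div 2)"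

declare cube_edges.simps [simp del]

lemma cube_edges_0 [simp]: "cube_edges 0 = 0" and cube_edges_1 [simp]: "cube_edges (Suc 0) = 0"
  by (simp_all add: cube_edges.simps)

lemma cube_edges_double: "cube_edges (2 * t) = 2 * cube_edges t + t"
  by (cases "t = 0") (simp_all add: cube_edges.simps[of "2 * t"])

lemma cube_edges_double_Suc: "cube_edges (2 * t + 1) = cube_edges t + cube_edges (t + 1) + t"
  by (cases "t = 0") (simp_all add: cube_edges.simps[of "Suc (2 * t)"])

text \<open>Halving both arguments reduces the claim to their rounded halves through the two
  recurrences. It serves to glue facets: \<open>min a b\<close> is the most edges that a matching
  between sets of sizes \<open>a\<close> and \<open>b\<close> can have.\<close>

lemma cube_edges_superadditive:
  "cube_edges a + cube_edges b + min a b \<le> cube_edges (a + b)"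
proof (induction "a + b" arbitrary: a b rule: less_induct)
  case less
  show ?case
  proof (cases "a = 0 \<or> b = 0 \<or> (a = 1 \<and> b = 1)")
    case True
    then show ?thesis using cube_edges_double[of 1] by (auto simp: numeral_2_eq_2)
  next
    case False
    define x y where "x = a div 2" and "y = b div 2"
    have IH: "cube_edges u + cube_edges v + min u v \<le> cube_edges (u + v)"
      if "u \<in> {x, x + 1}" "v \<in> {y, y + 1}" "u + v < a + b" for u v
      using less that by blast
    consider "a = 2 * x" "b = 2 * y" | "a = 2 * x + 1" "b = 2 * y"
      | "a = 2 * x" "b = 2 * y + 1" | "a = 2 * x + 1" "b = 2 * y + 1"
      unfolding x_def y_def by linarith
    then show ?thesis
    proof cases
      case 1
      then have s: "a + b = 2 * (x + y)" by simp
      have "x + y < a + b" using 1 False by auto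
      then have "cube_edges x + cube_edges y + min x y \<le> cube_edges (x + y)" by (intro IH) auto
      then show ?thesis unfolding s unfolding 1 cube_edges_double by linarith
    next
      case 2
      then have s: "a + b = 2 * (x + y) + 1" by simp
      have "x + 1 + y < a + b" using 2 False by auto
      then have "cube_edges x + cube_edges y + min x y \<le> cube_edges (x + y)"
        "cube_edges (x + 1) + cube_edges y + min (x + 1) y \<le> cube_edges (x + 1 + y)"
        by (intro IH; simp)+
      then show ?thesis unfolding s unfolding 2 cube_edges_double cube_edges_double_Suc
        by (simp add: min_def split: if_splits)
    next
      case 3
      then have s: "a + b = 2 * (x + y) + 1" by simp
      have "x + 1 + y < a + b" using 3 False by auto
      then have "cube_edges x + cube_edges y + min x y \<le> cube_edges (x + y)"
        "cube_edges x + cube_edges (y + 1) + min x (y + 1) \<le> cube_edges (x + (y + 1))"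
        by (intro IH; simp)+
      then show ?thesis unfolding s unfolding 3 cube_edges_double cube_edges_double_Suc
        by (simp add: min_def split: if_splits)
    next
      case 4
      then have s: "a + b = 2 * (x + y + 1)" by simp
      have "x + 1 + y < a + b" using 4 False by auto
      \<comment> \<open>Each rounded-down half is paired with the other argument's rounded-up half,
        so that both sums equal \<open>x + y + 1\<close>, half of \<open>a + b\<close>.\<close>
      then have "cube_edges x + cube_edges (y + 1) + min x (y + 1) \<le> cube_edges (x + (y + 1))"
        "cube_edges (x + 1) + cube_edges y + min (x + 1) y \<le> cube_edges (x + 1 + y)"
        by (intro IH; simp)+
      then show ?thesis unfolding s unfolding 4 cube_edges_double cube_edges_double_Suc
        by (simp add: min_def split: if_splits)
    qed
  qed
qed

text \<open>A segment longer than \<open>2 ^ k\<close> fills a subcube, and each of the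
  \<open>t\<close> remaining vertices has one neighbour there: a case of equality in
  superadditivity. The recursion strips the lowest bit, not the highest, hence the induction by
  halving.\<close>

lemma cube_edges_add_power2:
  "t \<le> 2 ^ k \<Longrightarrow> cube_edges (2 ^ k + t) = cube_edges (2 ^ k) + t + cube_edges t"
proof (induction k arbitrary: t)
  case 0
  then show ?case by (cases t) (auto simp: cube_edges.simps[of "Suc (Suc 0)"])
next
  case (Suc k)
  define s where "s = t div 2"
  consider "t = 2 * s" | "t = 2 * s + 1" unfolding s_def by linarith
  then show ?case
  proof cases
    case 1
    have e: "2 ^ Suc k + t = 2 * (2 ^ k + s)" using 1 by simp
    have "s \<le> 2 ^ k" using Suc.prems 1 by simp
    then show ?thesis unfolding e unfolding 1 cube_edges_double
      using Suc.IH[of s] cube_edges_double[of "2 ^ k"] by simp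
  next
    case 2
    have e: "2 ^ Suc k + t = 2 * (2 ^ k + s) + 1" using 2 by simp
    have "s + 1 \<le> 2 ^ k" using Suc.prems 2 by simp
    then show ?thesis unfolding e unfolding 2 unfolding cube_edges_double_Suc
      using Suc.IH[of s] Suc.IH[of "s + 1"] cube_edges_double[of "2 ^ k"]
      by (simp add: add.assoc)
  qed
qed

section \<open>Bounds for \<open>cube_edges\<close> and their equality cases\<close>

lemma cube_edges_power2: "2 * cube_edges (2 ^ k) = k * 2 ^ k"
  by (induction k) (auto simp: cube_edges_double)

text \<open>The cube is \<open>k\<close>-regular and connected. Numerically,
  \<open>t = 2 ^ k + s\<close> in dimension \<open>k + 1\<close> gains at least the slack
  \<open>2 ^ k - s\<close>, which vanishes only for the full cube.\<close>

lemma cube_edges_le: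
  "t \<le> 2 ^ k \<Longrightarrow> 2 * cube_edges t \<le> k * t \<and> (2 * cube_edges t = k * t \<longrightarrow> t = 0 \<or> t = 2 ^ k)"
proof (induction k arbitrary: t)
  case 0
  then show ?case by (cases t) auto
next
  case (Suc k)
  show ?case
  proof (cases "t \<le> 2 ^ k")
    case True
    then show ?thesis using Suc.IH[OF True] by auto
  next
    case False
    define s where "s = t - 2 ^ k"
    have s: "t = 2 ^ k + s" "s \<le> 2 ^ k" using False Suc.prems by (auto simp: s_def)
    show ?thesis using Suc.IH[OF s(2)] cube_edges_power2[of k] cube_edges_add_power2[OF s(2)] s
      by (auto simp: algebra_simps)
  qed
qed

text \<open>In the \<open>k\<close>-regular cube a segment and its complement have the same
  boundary, and bitwise negation turns the complement into a segment again. The two boundary counts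
  are compared without subtraction.\<close>

lemma cube_edges_complement:
  "a + b = 2 ^ k \<Longrightarrow> k * a + 2 * cube_edges b = k * b + 2 * cube_edges a"
proof (induction k arbitrary: a b)
  case 0
  then show ?case by (cases a) auto
next
  case (Suc k)
  \<comment> \<open>By symmetry \<open>a\<close> is the larger part; what it has beyond a full half
    cube is complementary to \<open>b\<close> in the other half.\<close>
  have *: "Suc k * a + 2 * cube_edges b = Suc k * b + 2 * cube_edges a"
    if "a + b = 2 ^ Suc k" "2 ^ k \<le> a" for a b
  proof -
    define s where "s = a - 2 ^ k"
    have s: "a = 2 ^ k + s" "s + b = 2 ^ k" using that by (auto simp: s_def)
    then have "2 * cube_edges a = k * 2 ^ k + 2 * s + 2 * cube_edges s"
      using cube_edges_power2[of k] cube_edges_add_power2[of s k] by simp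
    moreover have "k * s + 2 * cube_edges b = k * b + 2 * cube_edges s"
      by (rule Suc.IH) (rule s)
    moreover have "k * 2 ^ k = k * s + k * b" using s by (metis distrib_left)
    ultimately show ?thesis using s by (simp add: algebra_simps)
  qed
  show ?case
  proof (cases "2 ^ k \<le> a")
    case True
    then show ?thesis using *[of a b] Suc.prems by simp
  next
    case False
    then show ?thesis using *[of b a] Suc.prems by simp
  qed
qed

text \<open>Past \<open>2 ^ k\<close>, put \<open>t = 2 ^ k + s\<close>. Then
  \<open>k * t - 2 * cube_edges t = (k - 2) * s - 2 * cube_edges s\<close>, and
  \<open>3 * t \<le> 4 * 2 ^ k\<close> becomes \<open>3 * s \<le> 4 * 2 ^ (k - 2)\<close>: the
  constant 4/3 = 1 + 1/4 + 1/16 + ... reproduces itself.\<close>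

lemma cube_edges_extremal:
  "3 * t \<le> 4 * 2 ^ k \<Longrightarrow> 2 * cube_edges t \<le> k * t \<and>
   (2 * cube_edges t = k * t \<longrightarrow> t = 0 \<or> (\<exists>j. 2 * j \<le> k \<and> t = (\<Sum>i\<le>j. 2 ^ (k - 2 * i))))"
proof (induction k arbitrary: t rule: less_induct)
  case (less k)
  show ?case
  proof (cases "t \<le> 2 ^ k")
    case True
    have "\<exists>j. 2 * j \<le> k \<and> 2 ^ k = (\<Sum>i\<le>j. 2 ^ (k - 2 * i) :: nat)" by (intro exI[of _ 0]) auto
    then show ?thesis using cube_edges_le[OF True] by auto
  next
    case False
    define s where "s = t - 2 ^ k"
    have s: "t = 2 ^ k + s" "3 * s \<le> 2 ^ k" "s > 0" using False less.prems by (auto simp: s_def)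
    \<comment> \<open>For \<open>k \<le> 1\<close> the bound \<open>3 * s \<le> 2 ^ k\<close> leaves
      no positive \<open>s\<close>.\<close>
    have k: "k \<ge> 2"
    proof (rule ccontr)
      assume "\<not> k \<ge> 2"
      then have "k = 0 \<or> k = 1" by auto
      then show False using s by auto
    qed
    then obtain l where l: "k = l + 2" by (metis add.commute le_Suc_ex)
    have IH: "2 * cube_edges s \<le> l * s"
      "2 * cube_edges s = l * s \<longrightarrow> s = 0 \<or> (\<exists>j. 2 * j \<le> l \<and> s = (\<Sum>i\<le>j. 2 ^ (l - 2 * i)))"
      using less.IH[of l s] s(2) l by auto
    have e: "2 * cube_edges t = k * 2 ^ k + 2 * s + 2 * cube_edges s"
      using cube_edges_power2[of k] cube_edges_add_power2[of s k] s by simp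
    show ?thesis
    proof (intro conjI impI)
      show "2 * cube_edges t \<le> k * t" using e IH s l by (simp add: algebra_simps)
      assume "2 * cube_edges t = k * t"
      then have "2 * cube_edges s = l * s" using e s l by (simp add: algebra_simps)
      then obtain j where j: "2 * j \<le> l" "s = (\<Sum>i\<le>j. 2 ^ (l - 2 * i))" using IH s by auto
      have "t = (\<Sum>i\<le>Suc j. 2 ^ (k - 2 * i))"
        by (subst sum.atMost_Suc_shift) (simp add: s(1) j(2) l)
      then show "t = 0 \<or> (\<exists>j. 2 * j \<le> k \<and> t = (\<Sum>i\<le>j. 2 ^ (k - 2 * i)))"
        using j l by (intro disjI2 exI[of _ "Suc j"]) auto
    qed
  qed
qed

text \<open>The same stripping read backwards. The size bound is carried through the induction
  because it keeps the remainder below the leading power.\<close>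

lemma sum_power2_extremal:
  fixes k j :: nat
  assumes "2 * j \<le> k"
  defines "t \<equiv> \<Sum>i\<le>j. 2 ^ (k - 2 * i)"
  shows "3 * t \<le> 4 * 2 ^ k" and "2 * cube_edges t = k * t"
proof -
  have "3 * t \<le> 4 * 2 ^ k \<and> 2 * cube_edges t = k * t"
    using assms(1) unfolding t_def
  proof (induction j arbitrary: k)
    case 0
    then show ?case by (simp add: cube_edges_power2)
  next
    case (Suc j)
    then obtain l where l: "k = l + 2" by (metis add.commute le_Suc_ex mult_Suc_right add_leD1)
    define s :: nat where "s = (\<Sum>i\<le>j. 2 ^ (l - 2 * i))"
    have t: "(\<Sum>i\<le>Suc j. 2 ^ (k - 2 * i)) = 2 ^ k + s"
      by (subst sum.atMost_Suc_shift) (simp add: s_def l)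
    have IH: "3 * s \<le> 4 * 2 ^ l" "2 * cube_edges s = l * s"
      using Suc.IH[of l] Suc.prems l by (auto simp: s_def)
    have "2 * cube_edges (2 ^ k + s) = k * 2 ^ k + 2 * s + 2 * cube_edges s"
      using cube_edges_power2[of k] cube_edges_add_power2[of s k] IH l by simp
    then show ?case unfolding t using IH l by (simp add: algebra_simps)
  qed
  then show "3 * t \<le> 4 * 2 ^ k" and "2 * cube_edges t = k * t" by auto
qed

subsection \<open>Inner degree sums in the folded hypercube\<close>

definition slice :: "bool \<Rightarrow> bool list set \<Rightarrow> bool list set" where
  "slice b X = {xs. b # xs \<in> X}"

definition flip :: "nat \<Rightarrow> bool list \<Rightarrow> bool list" where
  "flip i x = x[i := \<not> x ! i]"

text \<open>The degree sums below count every inner edge twice. In dimension 0 and 1 the complement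
  edge of \<open>fold_deg\<close> degenerates to a loop or a double edge, which is what the induction in
  \<open>fold_deg_le\<close> starts from.\<close>

definition cube_deg :: "nat \<Rightarrow> bool list set \<Rightarrow> nat" where
  "cube_deg n X = (\<Sum>i<n. card {x \<in> X. flip i x \<in> X})"

definition fold_deg :: "nat \<Rightarrow> bool list set \<Rightarrow> nat" where
  "fold_deg n X = cube_deg n X + card (X \<inter> map Not ` X)"

definition enh_deg :: "nat \<Rightarrow> bool list set \<Rightarrow> nat" where
  "enh_deg n X = cube_deg n X + card {x \<in> X. hd x # map Not (tl x) \<in> X}"

section \<open>Recursion of the degree sums along the head coordinate\<close>

lemma finite_strings [simp]: "finite {x :: bool list. length x = n}"
  using finite_lists_length_eq[of "UNIV :: bool set" n] by simp

lemma card_strings: "card {x :: bool list. length x = n} = 2 ^ n"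
  using card_lists_length_eq[of "UNIV :: bool set" n] by simp

lemma slice_subset: "X \<subseteq> {x. length x = Suc n} \<Longrightarrow> slice b X \<subseteq> {x. length x = n}"
  by (auto simp: slice_def)

lemma finite_stringsI: "X \<subseteq> {x :: bool list. length x = n} \<Longrightarrow> finite X"
  by (rule finite_subset[OF _ finite_strings])

lemma finite_slice: "X \<subseteq> {x. length x = Suc n} \<Longrightarrow> finite (slice b X)"
  by (rule finite_stringsI[OF slice_subset])

lemma card_slices:
  assumes "X \<subseteq> {x. length x = Suc n}"
  shows "card {x \<in> X. P x} = card {x \<in> slice True X. P (True # x)} + card {x \<in> slice False X. P (False # x)}"
proof -
  have e: "{x \<in> X. P x} = (#) True ` {x \<in> slice True X. P (True # x)} \<union> (#) False ` {x \<in> slice False X. P (False # x)}"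
    (is "_ = ?A \<union> ?B")
  proof (intro equalityI subsetI)
    fix x assume x: "x \<in> {x \<in> X. P x}"
    then have "length x = Suc n" using assms by auto
    then obtain b y where "x = b # y" by (auto simp: length_Suc_conv)
    then show "x \<in> ?A \<union> ?B" using x by (cases b) (auto simp: slice_def)
  qed (auto simp: slice_def)
  have f: "finite (slice b X)" for b by (rule finite_slice[OF assms])
  have "card (?A \<union> ?B) = card ?A + card ?B"
    using f by (intro card_Un_disjoint) auto
  then show ?thesis unfolding e by (simp add: card_image)
qed

lemma card_slice_add:
  assumes "X \<subseteq> {x. length x = Suc n}"
  shows "card X = card (slice True X) + card (slice False X)"
  using card_slices[OF assms, of "\<lambda>_. True"] by simp

lemma cube_deg_Suc:
  assumes X: "X \<subseteq> {x. length x = Suc n}"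
  shows "cube_deg (Suc n) X =
    cube_deg n (slice True X) + cube_deg n (slice False X) + 2 * card (slice True X \<inter> slice False X)"
proof -
  have 0: "card {x \<in> X. flip 0 x \<in> X} = 2 * card (slice True X \<inter> slice False X)"
    unfolding card_slices[OF X]
    by (simp add: flip_def slice_def Int_def conj_commute)
  have "card {x \<in> X. flip (Suc i) x \<in> X} =
    card {x \<in> slice True X. flip i x \<in> slice True X} + card {x \<in> slice False X. flip i x \<in> slice False X}" for i
    unfolding card_slices[OF X] by (simp add: flip_def slice_def)
  then show ?thesis
    unfolding cube_deg_def sum.lessThan_Suc_shift by (simp add: 0 sum.distrib)
qed

lemma Not_comp_Not [simp]: "Not \<circ> Not = (\<lambda>x. x)"
  by auto

lemma in_image_map_Not: "x \<in> map Not ` X \<longleftrightarrow> map Not x \<in> X"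
  by (force simp: image_iff)

lemma inj_map_Not: "inj_on (map Not) X"
  by (simp add: inj_on_def)

lemma card_image_map_Not [simp]: "card (map Not ` X) = card X"
  by (rule card_image[OF inj_map_Not])

lemma card_Int_map_Not: "card (A \<inter> map Not ` B) = card (B \<inter> map Not ` A)"
proof -
  have "B \<inter> map Not ` A = map Not ` (A \<inter> map Not ` B)"
    by (auto simp: in_image_map_Not)
  then show ?thesis by simp
qed

text \<open>Complementing changes the head, so every antipodal edge runs between the slices: it
  forms a second matching, and the slices themselves contribute only
  \<open>cube_deg\<close>.\<close>

lemma fold_deg_Suc:
  assumes X: "X \<subseteq> {x. length x = Suc n}"
  shows "fold_deg (Suc n) X = cube_deg n (slice True X) + cube_deg n (slice False X)
    + 2 * card (slice True X \<inter> slice False X) + 2 * card (slice True X \<inter> map Not ` slice False X)"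
proof -
  have "card (X \<inter> map Not ` X) = card {x \<in> X. map Not x \<in> X}"
    by (simp add: Int_def in_image_map_Not)
  also have "\<dots> = card (slice True X \<inter> map Not ` slice False X) + card (slice False X \<inter> map Not ` slice True X)"
    unfolding card_slices[OF X] by (simp add: Int_def in_image_map_Not slice_def)
  finally show ?thesis
    unfolding fold_deg_def cube_deg_Suc[OF X] by (simp add: card_Int_map_Not[of "slice False X"])
qed

text \<open>Here the complement keeps the head, so each slice is a folded hypercube and one matching
  joins the two.\<close>

lemma enh_deg_Suc:
  assumes X: "X \<subseteq> {x. length x = Suc n}"
  shows "enh_deg (Suc n) X =
    fold_deg n (slice True X) + fold_deg n (slice False X) + 2 * card (slice True X \<inter> slice False X)"
proof -
  have "card {x \<in> X. hd x # map Not (tl x) \<in> X} =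
    card (slice True X \<inter> map Not ` slice True X) + card (slice False X \<inter> map Not ` slice False X)"
    unfolding card_slices[OF X] by (simp add: Int_def in_image_map_Not slice_def)
  then show ?thesis
    unfolding enh_deg_def fold_deg_def cube_deg_Suc[OF X] by simp
qed

text \<open>The edge-isoperimetric inequality of the cube: the matching has at most as many edges as
  the smaller slice has vertices, which superadditivity absorbs.\<close>

lemma cube_deg_le: "X \<subseteq> {x. length x = n} \<Longrightarrow> cube_deg n X \<le> 2 * cube_edges (card X)"
proof (induction n arbitrary: X)
  case 0
  then show ?case by (simp add: cube_deg_def)
next
  case (Suc n)
  let ?A = "slice True X" and ?B = "slice False X"
  have f: "finite ?A" "finite ?B" by (rule finite_slice[OF Suc.prems])+
  have "card (?A \<inter> ?B) \<le> min (card ?A) (card ?B)"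
    using f by (simp add: card_mono)
  then show ?case
    unfolding cube_deg_Suc[OF Suc.prems] card_slice_add[OF Suc.prems]
    using cube_edges_superadditive[of "card ?A" "card ?B"]
      Suc.IH[OF slice_subset[OF Suc.prems, of True]] Suc.IH[OF slice_subset[OF Suc.prems, of False]]
    by linarith
qed

text \<open>The antipodal pairs inside \<open>A\<close> and \<open>B\<close> pay for the second matching between the two
  half cubes.\<close>

lemma card_Int_antipodal_le_left:
  assumes f: "finite A" "finite B"
  shows "2 * card (A \<inter> B) + 2 * card (A \<inter> map Not ` B)
    \<le> 2 * card A + card (A \<inter> map Not ` A) + card (B \<inter> map Not ` B)"
proof -
  define N where "N = image (map Not)"
  have N: "x \<in> N X \<longleftrightarrow> map Not x \<in> X" for x X by (simp add: N_def in_image_map_Not)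
  \<comment> \<open>\<open>D\<close> is the antipodally closed part of \<open>B\<close>; exactly the
    elements of \<open>A \<inter> D\<close> meet both matchings. \<open>P\<close> and
    \<open>Q\<close> sort them by whether the antipode is in \<open>A\<close>.\<close>
  define D P Q where "D = B \<inter> N B" and "P = A \<inter> D \<inter> N A" and "Q = A \<inter> D - N A"
  have "card (A \<inter> B) + card (A \<inter> N B) = card (A \<inter> (B \<union> N B)) + card (A \<inter> D)"
    using card_Un_Int[of "A \<inter> B" "A \<inter> N B"] f
    by (simp add: D_def Int_Un_distrib Int_ac)
  moreover have "card (A \<inter> (B \<union> N B)) \<le> card A" using f by (simp add: card_mono)
  moreover have "card (A \<inter> D) = card P + card Q"
    unfolding P_def Q_def by (subst card_Un_disjoint[symmetric]) (use f in \<open>auto intro!: arg_cong[where f = card]\<close>)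
  moreover have "card P \<le> card (A \<inter> N A)" using f by (auto simp: P_def intro: card_mono)
  \<comment> \<open>The antipodes of \<open>Q\<close> lie in \<open>D\<close> but outside
    \<open>A\<close>, so every element of \<open>Q\<close> can be charged to two elements of
    \<open>D\<close>.\<close>
  moreover have "card P + (card Q + card (N Q)) \<le> card D"
  proof -
    have d: "Q \<inter> N Q = {}" "P \<inter> (Q \<union> N Q) = {}" by (auto simp: P_def Q_def N)
    have fin: "finite P" "finite Q" "finite (N Q)" using f by (auto simp: P_def Q_def N_def)
    have "card P + (card Q + card (N Q)) = card (P \<union> (Q \<union> N Q))"
      using d fin by (simp add: card_Un_disjoint)
    also have "\<dots> \<le> card D"
      using f by (intro card_mono) (auto simp: P_def Q_def D_def N)
    finally show ?thesis .
  qed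
  moreover have "card (N Q) = card Q" by (simp add: N_def)
  ultimately show ?thesis unfolding N_def[symmetric] D_def by linarith
qed

lemma card_Int_antipodal:
  assumes "finite A" "finite B"
  shows "2 * card (A \<inter> B) + 2 * card (A \<inter> map Not ` B)
    \<le> 2 * min (card A) (card B) + card (A \<inter> map Not ` A) + card (B \<inter> map Not ` B)"
  using card_Int_antipodal_le_left[of A B] card_Int_antipodal_le_left[of B A] assms card_Int_map_Not[of A B]
  by (simp add: Int_commute min_def)

text \<open>Superadditivity for the slices \<open>2 ^ k + b\<close> and \<open>a\<close> lacks the
  term \<open>min a b\<close>. It is gained by stripping \<open>2 ^ k\<close> first and adding
  \<open>a\<close> to \<open>b\<close>; if this carries past \<open>2 ^ k\<close>, exactly the
  overflow is lost.\<close>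

lemma cube_edges_large_slice:
  assumes "b \<le> 2 ^ k" "a \<le> 2 ^ k"
  shows "cube_edges (2 ^ k + b) + cube_edges a + a + min a b
    \<le> cube_edges (2 ^ k + b + a) + (b + a - 2 ^ k)"
proof (cases "a + b \<le> 2 ^ k")
  case True
  then show ?thesis
    using cube_edges_add_power2[OF True] cube_edges_add_power2[OF assms(1)] cube_edges_superadditive[of a b]
    by (simp add: ac_simps)
next
  case False
  define t where "t = a + b - 2 ^ k"
  have t: "a + b = 2 ^ k + t" "t \<le> 2 ^ k" using False assms by (auto simp: t_def)
  have e: "2 ^ k + b + a = 2 ^ Suc k + t" using t by simp
  have d: "cube_edges (2 ^ Suc k) = 2 * cube_edges (2 ^ k) + 2 ^ k"
    by (simp add: cube_edges_double)
  show ?thesis unfolding e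
    using d t cube_edges_add_power2[of t "Suc k"] cube_edges_add_power2[of t k]
      cube_edges_add_power2[OF assms(1)] cube_edges_superadditive[of a b] by simp
qed

text \<open>Neither bound on \<open>D\<close> suffices alone: the first is too weak when only one slice exceeds
  half of its cube.\<close>

lemma cube_edges_slices_fold:
  fixes D a b :: nat
  assumes ab: "a \<le> 2 ^ n" "b \<le> 2 ^ n"
    and D1: "D \<le> 2 * cube_edges a + (2 * a - 2 ^ n) + 2 * cube_edges b + (2 * b - 2 ^ n) + 2 * min a b"
    and D2: "D \<le> 2 * cube_edges a + 2 * cube_edges b + 4 * min a b"
  shows "D \<le> 2 * cube_edges (a + b) + (2 * (a + b) - 2 ^ Suc n)"
proof -
  have *: "D \<le> 2 * cube_edges (a + b) + (2 * (a + b) - 2 ^ Suc n)"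
    if ab: "a \<le> 2 ^ n" "b < a"
    and D1: "D \<le> 2 * cube_edges a + (2 * a - 2 ^ n) + 2 * cube_edges b + (2 * b - 2 ^ n) + 2 * b"
    and D2: "D \<le> 2 * cube_edges a + 2 * cube_edges b + 4 * b"
    and h: "2 ^ n < 2 * a" "2 * b < 2 ^ n" for a b
  proof (cases n)
    case 0
    then show ?thesis using that by simp
  next
    case (Suc k)
    define c where "c = a - 2 ^ k"
    have c: "a = 2 ^ k + c" "c \<le> 2 ^ k" "b \<le> 2 ^ k" using h ab Suc by (auto simp: c_def)
    \<comment> \<open>With \<open>a = 2 ^ k + c\<close>, the bound \<open>D2\<close> settles
      \<open>b \<le> c\<close>; for \<open>c < b\<close> the bound \<open>D1\<close> does, its
      truncated terms being \<open>2 * c\<close> and 0.\<close>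
    show ?thesis
      using cube_edges_large_slice[OF c(2,3)] D1 D2 h(2) c Suc by (auto simp: min_def split: if_splits)
  qed
  consider "2 * a \<le> 2 ^ n \<and> 2 * b \<le> 2 ^ n \<or> 2 * a \<ge> 2 ^ n \<and> 2 * b \<ge> 2 ^ n"
    | "2 ^ n < 2 * a" "2 * b < 2 ^ n" | "2 ^ n < 2 * b" "2 * a < 2 ^ n" by linarith
  then show ?thesis
  proof cases
    case 1
    then show ?thesis using D1 cube_edges_superadditive[of a b] by auto
  next
    case 2
    then show ?thesis using *[of a b] ab D1 D2 by simp
  next
    case 3
    then show ?thesis using *[of b a] ab D1 D2 by (simp add: ac_simps)
  qed
qed

text \<open>Antipodal pairs inside a slice count in the slice's \<open>fold_deg\<close> but not in
  that of \<open>X\<close>. Subtracting them from the induction hypothesis offsets the same terms in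
  \<open>card_Int_antipodal\<close>. The second bound uses the plain cube inequality and estimates
  each matching separately.\<close>

lemma fold_deg_le:
  "X \<subseteq> {x. length x = n} \<Longrightarrow> fold_deg n X \<le> 2 * cube_edges (card X) + (2 * card X - 2 ^ n)"
proof (induction n arbitrary: X)
  case 0
  then have "X = {} \<or> X = {[]}" by auto
  then show ?case by (auto simp: fold_deg_def cube_deg_def)
next
  case (Suc n)
  let ?A = "slice True X" and ?B = "slice False X"
  have s: "slice b X \<subseteq> {x. length x = n}" for b by (rule slice_subset[OF Suc.prems])
  have f: "finite ?A" "finite ?B" by (rule finite_slice[OF Suc.prems])+
  have c: "card (slice b X) \<le> 2 ^ n" for b
    using card_mono[OF finite_strings s] by (simp add: card_strings)
  have IH: "fold_deg n (slice b X) \<le> 2 * cube_edges (card (slice b X)) + (2 * card (slice b X) - 2 ^ n)" for b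
    using s by (rule Suc.IH)
  show ?case unfolding card_slice_add[OF Suc.prems]
  proof (rule cube_edges_slices_fold[OF c c])
    show "fold_deg (Suc n) X \<le> 2 * cube_edges (card ?A) + (2 * card ?A - 2 ^ n)
      + 2 * cube_edges (card ?B) + (2 * card ?B - 2 ^ n) + 2 * min (card ?A) (card ?B)"
      using IH[of True] IH[of False] card_Int_antipodal[OF f]
      unfolding fold_deg_Suc[OF Suc.prems] fold_deg_def[of n] by linarith
    have "card (?A \<inter> ?B) \<le> min (card ?A) (card ?B)" using f by (simp add: card_mono)
    moreover have "card (?A \<inter> map Not ` ?B) \<le> min (card ?A) (card ?B)"
      using f card_mono[of ?A "?A \<inter> map Not ` ?B"] card_mono[of "map Not ` ?B" "?A \<inter> map Not ` ?B"] by simp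
    ultimately show "fold_deg (Suc n) X
      \<le> 2 * cube_edges (card ?A) + 2 * cube_edges (card ?B) + 4 * min (card ?A) (card ?B)"
      unfolding fold_deg_Suc[OF Suc.prems]
      using cube_deg_le[OF s, of True] cube_deg_le[OF s, of False] by linarith
  qed
qed

subsection \<open>The isoperimetric inequality\<close>

text \<open>With \<open>k = n - 1\<close> these are the sizes \<open>m_val n r\<close>. The last
  family consists of complements in a subcube of dimension \<open>k - 2\<close>, written additively
  to avoid truncated subtraction.\<close>

definition extremal_sizes :: "nat \<Rightarrow> nat set" where
  "extremal_sizes k = {2 ^ k, 2 ^ (k - 2)} \<union>
     {m. \<exists>j. 2 * j \<le> k - 6 \<and> m + (\<Sum>i\<le>j. 2 ^ (k - 6 - 2 * i)) = 2 ^ (k - 2)}"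

text \<open>Three ranges: from \<open>2 ^ (k - 1)\<close> on, a slack of at least
  \<open>2 ^ (k - 1)\<close> remains; from \<open>2 ^ (k - 2)\<close> on, twice the distance to
  \<open>2 ^ (k - 2)\<close>; below, the complement in dimension \<open>k - 2\<close> is
  examined.\<close>

lemma cube_edges_profile:
  assumes "6 \<le> k" "11 * 2 ^ k \<le> 48 * m" "m \<le> 2 ^ k"
  shows "2 * cube_edges m + 2 ^ k \<le> (k + 2) * m"
    and "2 * cube_edges m + 2 ^ k = (k + 2) * m \<Longrightarrow> m \<in> extremal_sizes k"
proof -
  have "2 * cube_edges m + 2 ^ k \<le> (k + 2) * m \<and>
    (2 * cube_edges m + 2 ^ k = (k + 2) * m \<longrightarrow> m \<in> extremal_sizes k)"
  proof -
    consider "2 * m \<ge> 2 ^ k" | "2 * m < 2 ^ k" "4 * m \<ge> 2 ^ k" | "4 * m < 2 ^ k" by linarith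
    then show ?thesis
    proof cases
      case 1
      obtain l where l: "k = Suc l" using assms by (cases k) auto
      define t where "t = m - 2 ^ l"
      have t: "m = 2 ^ l + t" "t \<le> 2 ^ l" using 1 assms l by (auto simp: t_def)
      have "2 * cube_edges m \<le> l * 2 ^ l + 2 * t + l * t"
        using cube_edges_add_power2[OF t(2)] cube_edges_power2[of l] cube_edges_le[OF t(2)] t by simp
      then have "2 * cube_edges m + 2 ^ k + 2 ^ l \<le> (k + 2) * m" unfolding l t(1)
        by (simp add: algebra_simps)
      moreover have "(2::nat) ^ l > 0" by simp
      ultimately show ?thesis by linarith
    next
      case 2
      obtain l where l: "k = l + 2" using assms by (intro that[of "k - 2"]) simp
      define t where "t = m - 2 ^ l"
      have t: "m = 2 ^ l + t" "t \<le> 2 ^ l" using 2 assms l by (auto simp: t_def)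
      have "2 * cube_edges m \<le> l * 2 ^ l + 2 * t + l * t"
        using cube_edges_add_power2[OF t(2)] cube_edges_power2[of l] cube_edges_le[OF t(2)] t by simp
      then have "2 * cube_edges m + 2 ^ k + 2 * t \<le> (k + 2) * m" unfolding l t(1)
        by (simp add: algebra_simps)
      moreover have "m \<in> extremal_sizes k" if "t = 0" using that t l by (simp add: extremal_sizes_def)
      ultimately show ?thesis by auto
    next
      case 3
      obtain l where l: "k = l + 6" using assms by (intro that[of "k - 6"]) simp
      \<comment> \<open>11/48 = 1/4 - 1/48, and \<open>2 ^ k / 48\<close> is 4/3 of
        \<open>2 ^ (k - 6)\<close>: this is the range of \<open>cube_edges_extremal\<close> in
        dimension \<open>l\<close>.\<close>
      define t where "t = 2 ^ (l + 4) - m"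
      have t: "m + t = 2 ^ (l + 4)" "t > 0" "3 * t \<le> 4 * 2 ^ l"
        using 3 assms l by (auto simp: t_def power_add)
      have c: "(l + 4) * m + 2 * cube_edges t = (l + 4) * t + 2 * cube_edges m"
        by (rule cube_edges_complement[OF t(1)])
      \<comment> \<open>Substituting this for \<open>2 ^ k\<close> turns the claim into
        \<open>2 * cube_edges t \<le> l * t\<close>.\<close>
      have e: "2 ^ (l + 6) = 4 * m + 4 * t" using t(1) by (simp add: power_add)
      show ?thesis
      proof (intro conjI impI)
        show "2 * cube_edges m + 2 ^ k \<le> (k + 2) * m"
          using c cube_edges_extremal[OF t(3)] unfolding l e by (simp add: algebra_simps)
        assume "2 * cube_edges m + 2 ^ k = (k + 2) * m"
        then have "2 * cube_edges t = l * t" using c unfolding l e by (simp add: algebra_simps)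
        then obtain j where "2 * j \<le> l" "t = (\<Sum>i\<le>j. 2 ^ (l - 2 * i))"
          using cube_edges_extremal[OF t(3)] t(2) by auto
        then show "m \<in> extremal_sizes k" using t(1) by (auto simp: extremal_sizes_def l)
      qed
    qed
  qed
  then show "2 * cube_edges m + 2 ^ k \<le> (k + 2) * m"
    and "2 * cube_edges m + 2 ^ k = (k + 2) * m \<Longrightarrow> m \<in> extremal_sizes k" by auto
qed

text \<open>The size \<open>2 ^ k\<close> stands apart: there the cube edges alone fall short by
  \<open>2 ^ k\<close>, and the complement edges must make up the difference.\<close>

lemma cube_edges_extremal_sizes:
  assumes "6 \<le> k" "m \<in> extremal_sizes k"
  shows "m = 2 ^ k \<or> 2 * cube_edges m + 2 ^ k = (k + 2) * m" and "0 < m" "m \<le> 2 ^ k"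
proof -
  obtain l where l: "k = l + 6" using assms by (intro that[of "k - 6"]) simp
  consider "m = 2 ^ k" | "m = 2 ^ (k - 2)"
    | j where "2 * j \<le> l" "m + (\<Sum>i\<le>j. 2 ^ (l - 2 * i)) = 2 ^ (l + 4)"
    using assms by (auto simp: extremal_sizes_def l)
  then have "(m = 2 ^ k \<or> 2 * cube_edges m + 2 ^ k = (k + 2) * m) \<and> 0 < m \<and> m \<le> 2 ^ k"
  proof cases
    case 2
    then show ?thesis using cube_edges_power2[of "k - 2"] by (simp add: l power_add algebra_simps)
  next
    case 3
    define t :: nat where "t = (\<Sum>i\<le>j. 2 ^ (l - 2 * i))"
    have t: "m + t = 2 ^ (l + 4)" "3 * t \<le> 4 * 2 ^ l" "2 * cube_edges t = l * t"
      using 3 sum_power2_extremal[OF 3(1)] by (auto simp: t_def)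
    have c: "(l + 4) * m + 2 * cube_edges t = (l + 4) * t + 2 * cube_edges m"
      by (rule cube_edges_complement[OF t(1)])
    have e: "2 ^ (l + 6) = 4 * m + 4 * t" using t(1) by (simp add: power_add)
    have "m > 0"
    proof (rule ccontr)
      assume "\<not> m > 0"
      then show False using t by (simp add: power_add)
    qed
    then show ?thesis using c t(3) unfolding l e by (simp add: algebra_simps)
  qed simp
  then show "m = 2 ^ k \<or> 2 * cube_edges m + 2 ^ k = (k + 2) * m" "0 < m" "m \<le> 2 ^ k" by auto
qed

text \<open>If no slice exceeds half of its cube, the truncated terms vanish and superadditivity
  leads to \<open>cube_edges_profile\<close>. Otherwise the large slice is replaced by its
  complement of size \<open>c\<close>; a slack of \<open>c + b\<close> remains, so equality forces a
  full slice and an empty one.\<close>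

lemma prism_profile:
  assumes k: "6 \<le> k" and m: "11 * 2 ^ k \<le> 48 * (a + b)" "a + b \<le> 2 ^ k"
    and D: "D \<le> 2 * cube_edges a + (2 * a - 2 ^ k) + 2 * cube_edges b + (2 * b - 2 ^ k) + 2 * min a b"
  shows "D + 2 ^ k \<le> (k + 2) * (a + b)"
    and "D + 2 ^ k = (k + 2) * (a + b) \<Longrightarrow> a + b \<in> extremal_sizes k"
proof -
  have *: "D + 2 ^ k \<le> (k + 2) * (a + b) \<and> (D + 2 ^ k = (k + 2) * (a + b) \<longrightarrow> a + b = 2 ^ k)"
    if "2 ^ k < 2 * a" "a + b \<le> 2 ^ k"
      "D \<le> 2 * cube_edges a + (2 * a - 2 ^ k) + 2 * cube_edges b + (2 * b - 2 ^ k) + 2 * min a b" for a b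
  proof -
    obtain l where l: "k = Suc l" using k by (cases k) auto
    define c where "c = 2 ^ k - a"
    have c: "a + c = 2 ^ k" "c \<le> 2 ^ l" "b \<le> c" "b \<le> 2 ^ l" "b \<le> a" using that l by (auto simp: c_def)
    have e: "k * a + 2 * cube_edges c = k * c + 2 * cube_edges a"
      by (rule cube_edges_complement[OF c(1)])
    have "2 * cube_edges c \<le> l * c" "2 * cube_edges b \<le> l * b"
      using cube_edges_le[OF c(2)] cube_edges_le[OF c(4)] by simp_all
    moreover have "D + 2 ^ k \<le> 2 * cube_edges a + 2 * a + 2 * cube_edges b + 2 * b"
      using that c l by simp
    ultimately have "D + 2 ^ k + c + b \<le> (k + 2) * (a + b)"
      using e unfolding l by (simp add: algebra_simps)
    then show ?thesis using c by auto
  qed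
  have "D + 2 ^ k \<le> (k + 2) * (a + b) \<and> (D + 2 ^ k = (k + 2) * (a + b) \<longrightarrow> a + b \<in> extremal_sizes k)"
  proof -
    consider "2 ^ k < 2 * a" | "2 ^ k < 2 * b" | "2 * a \<le> 2 ^ k" "2 * b \<le> 2 ^ k" by linarith
    then show ?thesis
    proof cases
      case 1
      then show ?thesis using *[of a b] m D by (auto simp: extremal_sizes_def)
    next
      case 2
      then show ?thesis using *[of b a] m D by (auto simp: extremal_sizes_def ac_simps)
    next
      case 3
      then have "D \<le> 2 * cube_edges (a + b)" using D cube_edges_superadditive[of a b] by simp
      then show ?thesis using cube_edges_profile[OF k m] by linarith
    qed
  qed
  then show "D + 2 ^ k \<le> (k + 2) * (a + b)"
    and "D + 2 ^ k = (k + 2) * (a + b) \<Longrightarrow> a + b \<in> extremal_sizes k" by auto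
qed

lemma enh_deg_le:
  assumes X: "X \<subseteq> {x. length x = Suc k}" and k: "6 \<le> k"
    and m: "11 * 2 ^ k \<le> 48 * card X" "card X \<le> 2 ^ k"
  shows "enh_deg (Suc k) X + 2 ^ k \<le> (k + 2) * card X"
    and "enh_deg (Suc k) X + 2 ^ k = (k + 2) * card X \<Longrightarrow> card X \<in> extremal_sizes k"
proof -
  let ?A = "slice True X" and ?B = "slice False X"
  have "card (?A \<inter> ?B) \<le> min (card ?A) (card ?B)"
    using finite_slice[OF X] by (simp add: card_mono)
  then have D: "enh_deg (Suc k) X \<le> 2 * cube_edges (card ?A) + (2 * card ?A - 2 ^ k)
      + 2 * cube_edges (card ?B) + (2 * card ?B - 2 ^ k) + 2 * min (card ?A) (card ?B)"
    using fold_deg_le[OF slice_subset[OF X, of True]] fold_deg_le[OF slice_subset[OF X, of False]]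
    unfolding enh_deg_Suc[OF X] by linarith
  note m' = m[unfolded card_slice_add[OF X]]
  show "enh_deg (Suc k) X + 2 ^ k \<le> (k + 2) * card X"
    and "enh_deg (Suc k) X + 2 ^ k = (k + 2) * card X \<Longrightarrow> card X \<in> extremal_sizes k"
    unfolding card_slice_add[OF X] using prism_profile[OF k m' D] by blast+
qed

subsection \<open>Initial segments are extremal\<close>

fun val :: "bool list \<Rightarrow> nat" where
  "val [] = 0"
| "val (b # x) = (if b then 2 ^ length x else 0) + val x"

lemma val_less: "val x < 2 ^ length x"
  by (induction x) auto

lemma val_replicate_False [simp]: "val (replicate n False) = 0"
  by (induction n) auto

lemma val_replicate_True [simp]: "val (replicate n True) = 2 ^ n - 1"
  by (induction n) auto

lemma length_flip [simp]: "length (flip i x) = length x"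
  by (simp add: flip_def)

lemma flip_Cons [simp]: "flip 0 (b # x) = (\<not> b) # x" "flip (Suc i) (b # x) = b # flip i x"
  by (simp_all add: flip_def)

lemma val_flip:
  "i < length x \<Longrightarrow> if x ! i then val (flip i x) < val x else val x < val (flip i x)"
proof (induction x arbitrary: i)
  case (Cons b x)
  show ?case
  proof (cases i)
    case 0
    then show ?thesis by simp
  next
    case (Suc j)
    then show ?thesis using Cons.IH[of j] Cons.prems by (auto split: if_splits)
  qed
qed simp

definition initial_segment :: "nat \<Rightarrow> nat \<Rightarrow> bool list set" where
  "initial_segment n m = {x. length x = n \<and> val x < m}"

lemma initial_segment_subset: "initial_segment n m \<subseteq> {x. length x = n}"
  by (auto simp: initial_segment_def)

lemma slice_initial_segment [simp]:
  "slice True (initial_segment (Suc n) m) = initial_segment n (m - 2 ^ n)"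
  "slice False (initial_segment (Suc n) m) = initial_segment n m"
  by (auto simp: slice_def initial_segment_def)

lemma initial_segment_0 [simp]: "initial_segment n 0 = {}"
  by (simp add: initial_segment_def)

lemma initial_segment_min: "initial_segment n m = initial_segment n (min m (2 ^ n))"
  using val_less by (auto simp: initial_segment_def)

lemma card_initial_segment: "card (initial_segment n m) = min m (2 ^ n)"
proof (induction n arbitrary: m)
  case 0
  have "initial_segment 0 m = (if m = 0 then {} else {[]})" by (auto simp: initial_segment_def)
  then show ?case by simp
next
  case (Suc n)
  show ?case unfolding card_slice_add[OF initial_segment_subset] by (simp add: Suc)
qed

text \<open>Initial segments attain \<open>cube_deg_le\<close>: past \<open>2 ^ n\<close> one slice
  is a whole facet and the other a segment fully matched into it, as in
  \<open>cube_edges_add_power2\<close>.\<close>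

lemma cube_deg_initial_segment:
  "m \<le> 2 ^ n \<Longrightarrow> cube_deg n (initial_segment n m) = 2 * cube_edges m"
proof (induction n arbitrary: m)
  case 0
  then show ?case by (cases m) (auto simp: cube_deg_def)
next
  case (Suc n)
  have c0: "cube_deg n {} = 0" by (simp add: cube_deg_def)
  show ?case
  proof (cases "m \<le> 2 ^ n")
    case True
    then show ?thesis unfolding cube_deg_Suc[OF initial_segment_subset] by (simp add: Suc.IH c0)
  next
    case False
    define t where "t = m - 2 ^ n"
    have t: "m = 2 ^ n + t" "t \<le> 2 ^ n" using False Suc.prems by (auto simp: t_def)
    have f: "initial_segment n m = initial_segment n (2 ^ n)"
      by (subst initial_segment_min) (simp add: t(1))
    have "initial_segment n t \<inter> initial_segment n (2 ^ n) = initial_segment n t"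
      using t by (auto simp: initial_segment_def)
    then show ?thesis
      unfolding cube_deg_Suc[OF initial_segment_subset] slice_initial_segment f t_def[symmetric]
      using t by (simp add: Suc.IH card_initial_segment cube_edges_add_power2)
  qed
qed

text \<open>For \<open>m = 2 ^ k\<close> the segment is the facet with head \<open>False\<close>,
  closed under the complement, which adds \<open>m\<close>. For the other sizes the cube edges
  already suffice.\<close>

lemma enh_deg_initial_segment:
  assumes "6 \<le> k" "m \<in> extremal_sizes k"
  shows "(k + 2) * m \<le> enh_deg (Suc k) (initial_segment (Suc k) m) + 2 ^ k"
proof (cases "m = 2 ^ k")
  case True
  let ?X = "initial_segment (Suc k) m"
  have "{x \<in> ?X. hd x # map Not (tl x) \<in> ?X} = ?X"
  proof (intro equalityI subsetI CollectI conjI)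
    fix x assume x: "x \<in> ?X"
    then obtain b y where y: "x = b # y" "length y = k" by (cases x) (auto simp: initial_segment_def)
    then have "\<not> b" using x True by (auto simp: initial_segment_def)
    then show "hd x # map Not (tl x) \<in> ?X"
      using y True val_less[of "map Not y"] by (simp add: initial_segment_def)
  qed auto
  then have "enh_deg (Suc k) ?X = 2 * cube_edges m + m"
    unfolding enh_deg_def using True
    by (simp add: cube_deg_initial_segment card_initial_segment)
  then show ?thesis using True cube_edges_power2[of k] by (simp add: algebra_simps)
next
  case False
  have "m \<le> 2 ^ Suc k" using cube_edges_extremal_sizes(3)[OF assms] by simp
  then have "cube_deg (Suc k) (initial_segment (Suc k) m) = 2 * cube_edges m"
    by (rule cube_deg_initial_segment)
  then show ?thesis
    unfolding enh_deg_def using cube_edges_extremal_sizes(1)[OF assms] False by simp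
qed

subsection \<open>Edge cuts and connectivity\<close>

lemma sym_adj_rel: "sym (adj_rel G)"
  by (auto simp: adj_rel_def sym_def insert_commute)

lemma equiv_joined_rel: "equiv (verts G) (joined_rel G)"
proof (rule equivI)
  show "sym (joined_rel G)"
    using sym_rtrancl[OF sym_adj_rel[of G]] by (auto simp: joined_rel_def sym_def)
  show "trans (joined_rel G)"
    unfolding joined_rel_def by (rule transI) (auto intro: rtrancl_trans)
qed (auto simp: joined_rel_def refl_on_def)

text \<open>Descending along \<open>f\<close> from any vertex must end at \<open>r\<close>.\<close>

lemma connected_graphI:
  fixes f :: "'a \<Rightarrow> nat"
  assumes r: "r \<in> verts G"
    and step: "\<And>x. x \<in> verts G \<Longrightarrow> x \<noteq> r \<Longrightarrow> \<exists>y\<in>verts G. {x, y} \<in> edges G \<and> f y < f x"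
  shows "connected_graph G"
proof -
  have reach: "x \<in> verts G \<Longrightarrow> (x, r) \<in> (adj_rel G)\<^sup>*" for x
  proof (induction x rule: measure_induct_rule[of f])
    case (less x)
    show ?case
    proof (cases "x = r")
      case False
      then obtain y where "y \<in> verts G" "{x, y} \<in> edges G" "f y < f x"
        using step less.prems by blast
      then show ?thesis
        using less by (intro converse_rtrancl_into_rtrancl[of x y]) (auto simp: adj_rel_def)
    qed simp
  qed
  have "(x, r) \<in> joined_rel G" if "x \<in> verts G" for x
    using that r reach by (simp add: joined_rel_def)
  then show ?thesis
    unfolding connected_graph_def using r equiv_joined_rel[of G]
    by (metis empty_iff equivE symD transD)
qed

lemma joined_rel_mono:
  assumes "verts H \<subseteq> verts G" "edges H \<subseteq> edges G"
  shows "joined_rel H \<subseteq> joined_rel G"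
proof -
  have "adj_rel H \<subseteq> adj_rel G" using assms by (auto simp: adj_rel_def)
  then have "(adj_rel H)\<^sup>* \<subseteq> (adj_rel G)\<^sup>*" by (rule rtrancl_mono)
  then show ?thesis using assms by (auto simp: joined_rel_def)
qed

text \<open>Both sides stay connected after the deletion, so every component contains one side
  entirely; this alone bounds its size.\<close>

lemma extra_edge_cut_edges_between:
  assumes fin: "finite (verts G)" and X: "X \<subseteq> verts G"
    and conn: "connected_graph (induced G X)" "connected_graph (induced G (verts G - X))"
    and h: "h \<le> card X" "h \<le> card (verts G - X)"
  shows "extra_edge_cut h G (edges_between G X (verts G - X))"
proof -
  let ?F = "edges_between G X (verts G - X)"
  let ?H = "delete_edges G ?F"
  have V: "verts ?H = verts G" by (simp add: delete_edges_def)
  have big: "card Y \<le> card (joined_rel ?H `` {u})" if Y: "Y = X \<or> Y = verts G - X" and u: "u \<in> Y" for Y u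
  proof (rule card_mono)
    show "finite (joined_rel ?H `` {u})"
      by (rule finite_subset[OF _ fin]) (auto simp: joined_rel_def V)
    have "connected_graph (induced G Y)" using Y conn by auto
    then have "(u, v) \<in> joined_rel (induced G Y)" if "v \<in> Y" for v
      using u that by (simp add: connected_graph_def induced_def)
    moreover have "joined_rel (induced G Y) \<subseteq> joined_rel ?H"
      using X Y by (intro joined_rel_mono) (auto simp: induced_def delete_edges_def edges_between_def)
    ultimately show "Y \<subseteq> joined_rel ?H `` {u}" by auto
  qed
  have closed: "v \<in> X" if "(u, v) \<in> (adj_rel ?H)\<^sup>*" "u \<in> X" for u v
    using that
  proof (induction rule: rtrancl_induct)
    case (step y z)
    then show ?case by (auto simp: adj_rel_def delete_edges_def edges_between_def)
  qed
  have "\<not> connected_graph ?H"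
  proof
    assume c: "connected_graph ?H"
    obtain u v where "u \<in> X" "v \<in> verts G - X"
      using conn by (auto simp: connected_graph_def induced_def)
    then show False using c closed[of u v] X by (auto simp: connected_graph_def V joined_rel_def)
  qed
  moreover have "h \<le> card C" if C: "C \<in> components_of ?H" for C
  proof -
    obtain u where u: "u \<in> verts G" "C = joined_rel ?H `` {u}"
      using C by (auto simp: components_of_def V elim!: quotientE)
    show ?thesis
    proof (cases "u \<in> X")
      case True
      then show ?thesis using big[of X u] h u by simp
    next
      case False
      then show ?thesis using big[of "verts G - X" u] h u by simp
    qed
  qed
  moreover have "?F \<subseteq> edges G" by (auto simp: edges_between_def)
  ultimately show ?thesis by (simp add: extra_edge_cut_def)
qed

text \<open>Two components are disjoint, so one has at most half of the vertices; every edge leaving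
  a component was deleted.\<close>

lemma extra_edge_cut_small_component:
  assumes fin: "finite (verts G)" and ne: "verts G \<noteq> {}" and F: "extra_edge_cut h G F"
  obtains C where "C \<subseteq> verts G" "h \<le> card C" "2 * card C \<le> card (verts G)"
    "edges_between G C (verts G - C) \<subseteq> F"
proof -
  let ?H = "delete_edges G F"
  have V: "verts ?H = verts G" by (simp add: delete_edges_def)
  have eq: "equiv (verts G) (joined_rel ?H)" using equiv_joined_rel[of ?H] by (simp add: V)
  have sub: "joined_rel ?H `` {u} \<subseteq> verts G" for u by (auto simp: joined_rel_def V)
  have h: "h \<le> card (joined_rel ?H `` {u})" if "u \<in> verts G" for u
    using F that by (auto simp: extra_edge_cut_def components_of_def V intro: quotientI)
  have cut: "edges_between G (joined_rel ?H `` {u}) (verts G - joined_rel ?H `` {u}) \<subseteq> F" for u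
  proof (rule subsetI, rule ccontr)
    fix e
    assume "e \<in> edges_between G (joined_rel ?H `` {u}) (verts G - joined_rel ?H `` {u})" "e \<notin> F"
    then obtain x y where xy: "(u, x) \<in> joined_rel ?H" "y \<in> verts G" "(u, y) \<notin> joined_rel ?H"
      "{x, y} \<in> edges G - F" by (auto simp: edges_between_def)
    then have "(x, y) \<in> joined_rel ?H"
      by (auto simp: joined_rel_def adj_rel_def delete_edges_def)
    then show False using xy eq by (metis equivE transD)
  qed
  obtain u v where uv: "u \<in> verts G" "v \<in> verts G" "(u, v) \<notin> joined_rel ?H"
    using F ne by (auto simp: extra_edge_cut_def connected_graph_def V)
  define A B where "A = joined_rel ?H `` {u}" and "B = joined_rel ?H `` {v}"
  have "A \<inter> B = {}"
    using eq uv unfolding A_def B_def by (meson disjnt_def disjnt_equiv_class)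
  moreover have "A \<subseteq> verts G" "B \<subseteq> verts G" unfolding A_def B_def by (rule sub)+
  ultimately have "card A + card B \<le> card (verts G)"
    using fin by (metis card_Un_disjoint card_mono finite_subset Un_least)
  then consider "2 * card A \<le> card (verts G)" | "2 * card B \<le> card (verts G)" by linarith
  then show ?thesis
  proof cases
    case 1
    then show ?thesis using that[OF sub h[OF uv(1)] _ cut] by (simp add: A_def)
  next
    case 2
    then show ?thesis using that[OF sub h[OF uv(2)] _ cut] by (simp add: B_def)
  qed
qed

subsection \<open>The enhanced hypercube\<close>

lemma verts_enhanced [simp]: "verts (enhanced_hypercube n) = {x. length x = n}"
  by (simp add: enhanced_hypercube_def)

lemma finite_edges_enhanced: "finite (edges (enhanced_hypercube n))"
proof (rule finite_subset)
  show "edges (enhanced_hypercube n) \<subseteq> Pow {x. length x = n}" by (auto simp: enhanced_hypercube_def)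
qed simp

text \<open>All \<open>n + 1\<close> neighbours get an index, \<open>n\<close> standing for the
  complement edge, so that degree counts become sums over \<open>{..n}\<close>.\<close>

definition nbr :: "nat \<Rightarrow> nat \<Rightarrow> bool list \<Rightarrow> bool list" where
  "nbr n i x = (if i < n then flip i x else hd x # map Not (tl x))"

lemma length_nbr [simp]: "n \<noteq> 0 \<Longrightarrow> length x = n \<Longrightarrow> length (nbr n i x) = n"
  by (simp add: nbr_def)

lemma flip_flip [simp]: "flip i (flip i x) = x"
  by (cases "i < length x") (simp_all add: flip_def list_update_beyond)

lemma nbr_nbr: "n \<noteq> 0 \<Longrightarrow> length x = n \<Longrightarrow> nbr n i (nbr n i x) = x"
  by (cases x) (simp_all add: nbr_def)

lemma inj_nbr:
  assumes n: "3 \<le> n" and x: "length x = n"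
  shows "inj_on (\<lambda>i. nbr n i x) {..n}"
proof -
  have flip: "flip i x \<noteq> flip j x" if "i < n" "j < n" "i \<noteq> j" for i j
    using that x by (metis flip_def nth_list_update_eq nth_list_update_neq)
  have comp: "flip i x \<noteq> hd x # map Not (tl x)" if i: "i < n" for i
  proof
    assume e: "flip i x = hd x # map Not (tl x)"
    \<comment> \<open>Positions 1 and 2 lie in the tail because \<open>3 \<le> n\<close>; one of
      them differs from \<open>i\<close> and is changed by the complement only.\<close>
    obtain p where p: "p \<in> {1, 2}" "p \<noteq> i" by (metis insertCI numeral_eq_one_iff semiring_norm(85))
    then obtain q where q: "p = Suc q" "q < length (tl x)" using n x by (cases p) auto
    have "flip i x ! p = x ! p" using p by (simp add: flip_def)
    moreover have "(hd x # map Not (tl x)) ! p = (\<not> x ! p)" using q by (simp add: nth_tl)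
    ultimately show False using e by simp
  qed
  show ?thesis
  proof (rule inj_onI)
    fix i j
    assume "i \<in> {..n}" "j \<in> {..n}" "nbr n i x = nbr n j x"
    then show "i = j"
      using flip[of i j] comp[of i] comp[of j] by (auto simp: nbr_def split: if_splits)
  qed
qed

lemma enh_adj_iff_nbr:
  assumes x: "length x = n" "length y = n"
  shows "enh_adj x y \<longleftrightarrow> (\<exists>i\<le>n. y = nbr n i x)"
proof -
  have "card {i. i < n \<and> x ! i \<noteq> y ! i} = 1 \<longleftrightarrow> (\<exists>i<n. y = flip i x)"
  proof
    assume "card {i. i < n \<and> x ! i \<noteq> y ! i} = 1"
    then obtain i where i: "{i. i < n \<and> x ! i \<noteq> y ! i} = {i}" by (auto simp: card_1_singleton_iff)
    then have "i < n" by auto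
    moreover have "y = flip i x"
    proof (rule nth_equalityI)
      fix j assume "j < length y"
      then show "y ! j = flip i x ! j" using i x by (cases "j = i") (auto simp: flip_def)
    qed (simp add: x)
    ultimately show "\<exists>i<n. y = flip i x" by blast
  next
    assume "\<exists>i<n. y = flip i x"
    then obtain i where i: "i < n" "y = flip i x" by blast
    then have "{i. i < n \<and> x ! i \<noteq> y ! i} = {i}"
      using x by (auto simp: flip_def nth_list_update split: if_splits)
    then show "card {i. i < n \<and> x ! i \<noteq> y ! i} = 1" by simp
  qed
  then show ?thesis unfolding enh_adj_def x(1) by (auto simp: nbr_def order_le_less)
qed

lemma edge_enhanced_iff:
  assumes n: "n \<noteq> 0" and x: "length x = n" and y: "length y = n"
  shows "{x, y} \<in> edges (enhanced_hypercube n) \<longleftrightarrow> (\<exists>i\<le>n. y = nbr n i x)"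
proof -
  have "enh_adj x y \<longleftrightarrow> enh_adj y x"
    unfolding enh_adj_iff_nbr[OF x y] enh_adj_iff_nbr[OF y x] using nbr_nbr[OF n] x y by metis
  then have "{x, y} \<in> edges (enhanced_hypercube n) \<longleftrightarrow> enh_adj x y"
    using x y by (auto simp: enhanced_hypercube_def doubleton_eq_iff)
  then show ?thesis by (simp add: enh_adj_iff_nbr[OF x y])
qed

text \<open>Degree counting: \<open>enh_deg\<close> counts each inner edge from both ends. A
  boundary edge has a single end in \<open>X\<close>, and \<open>inj_nbr\<close> recovers the index,
  so boundary edges correspond to index-vertex pairs leading out of \<open>X\<close>.\<close>

lemma card_edges_between_enhanced:
  assumes n: "3 \<le> n" and X: "X \<subseteq> {x. length x = n}"
  defines "G \<equiv> enhanced_hypercube n"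
  shows "card (edges_between G X (verts G - X)) + enh_deg n X = (n + 1) * card X"
proof -
  define T where "T = (SIGMA i:{..n}. {x \<in> X. nbr n i x \<notin> X})"
  have fX: "finite X" using X by (rule finite_stringsI)
  have n0: "n \<noteq> 0" using n by simp
  have "bij_betw (\<lambda>(i, x). {x, nbr n i x}) T (edges_between G X (verts G - X))"
    unfolding bij_betw_def
  proof (intro conjI inj_onI equalityI subsetI)
    fix p q
    assume pq: "p \<in> T" "q \<in> T" "(case p of (i, x) \<Rightarrow> {x, nbr n i x}) = (case q of (i, x) \<Rightarrow> {x, nbr n i x})"
    obtain i x j y where [simp]: "p = (i, x)" "q = (j, y)" by (cases p, cases q)
    have xy: "x = y" "nbr n i x = nbr n j x" using pq by (auto simp: T_def doubleton_eq_iff)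
    then have "i = j" using pq X inj_onD[OF inj_nbr[OF n, of x], of i j] by (auto simp: T_def)
    then show "p = q" using xy by simp
  next
    fix e assume "e \<in> (\<lambda>(i, x). {x, nbr n i x}) ` T"
    then obtain i x where ix: "i \<le> n" "x \<in> X" "nbr n i x \<notin> X" "e = {x, nbr n i x}"
      by (auto simp: T_def)
    have l: "length x = n" "length (nbr n i x) = n" using ix X n0 by auto
    have "e \<in> edges G" unfolding ix(4) G_def edge_enhanced_iff[OF n0 l] using ix by auto
    then show "e \<in> edges_between G X (verts G - X)"
      using ix l by (auto simp: edges_between_def G_def)
  next
    fix e assume "e \<in> edges_between G X (verts G - X)"
    then obtain x y where xy: "x \<in> X" "length y = n" "y \<notin> X" "e = {x, y}" "{x, y} \<in> edges G"
      by (auto simp: edges_between_def G_def)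
    have l: "length x = n" using xy X by auto
    obtain i where "i \<le> n" "y = nbr n i x"
      using xy(5) unfolding G_def edge_enhanced_iff[OF n0 l xy(2)] by blast
    then show "e \<in> (\<lambda>(i, x). {x, nbr n i x}) ` T"
      using xy by (intro image_eqI[of _ _ "(i, x)"]) (auto simp: T_def)
  qed
  then have "card (edges_between G X (verts G - X)) = card T" by (simp add: bij_betw_same_card)
  also have "\<dots> = (\<Sum>i\<le>n. card {x \<in> X. nbr n i x \<notin> X})" unfolding T_def using fX by (simp add: card_SigmaI)
  finally have "card (edges_between G X (verts G - X)) = (\<Sum>i\<le>n. card {x \<in> X. nbr n i x \<notin> X})" .
  moreover have "enh_deg n X = (\<Sum>i\<le>n. card {x \<in> X. nbr n i x \<in> X})"
    unfolding enh_deg_def cube_deg_def lessThan_Suc_atMost[symmetric] by (simp add: nbr_def)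
  moreover have "card {x \<in> X. nbr n i x \<notin> X} + card {x \<in> X. nbr n i x \<in> X} = card X" for i
    using fX by (subst card_Un_disjoint[symmetric]) (auto intro: arg_cong[where f = card])
  ultimately show ?thesis by (simp add: sum.distrib[symmetric])
qed

text \<open>Clearing a bit lowers \<open>val\<close>, so the walk to the zero string never leaves
  the segment.\<close>

lemma connected_initial_segment:
  assumes m: "0 < m"
  shows "connected_graph (induced (enhanced_hypercube n) (initial_segment n m))"
proof (rule connected_graphI[where f = val and r = "replicate n False"])
  show "replicate n False \<in> verts (induced (enhanced_hypercube n) (initial_segment n m))"
    using m by (simp add: induced_def initial_segment_def)
  fix x assume "x \<in> verts (induced (enhanced_hypercube n) (initial_segment n m))" "x \<noteq> replicate n False"
  then have x: "length x = n" "val x < m" "x \<noteq> replicate n False"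
    by (auto simp: induced_def initial_segment_def)
  then obtain i where i: "i < n" "x ! i" by (metis (full_types) in_set_conv_nth replicate_eqI)
  have v: "val (flip i x) < val x" using val_flip[of i x] i x by simp
  have "{x, flip i x} \<in> edges (enhanced_hypercube n)"
    using i x by (subst edge_enhanced_iff) (auto simp: nbr_def intro!: exI[of _ i])
  then show "\<exists>y\<in>verts (induced (enhanced_hypercube n) (initial_segment n m)).
      {x, y} \<in> edges (induced (enhanced_hypercube n) (initial_segment n m)) \<and> val y < val x"
    using x v by (intro bexI[of _ "flip i x"]) (auto simp: induced_def initial_segment_def)
qed

text \<open>Dually, setting bits raises \<open>val\<close> and leads to the all-ones string; the
  measure \<open>2 ^ n - val x\<close> decreases.\<close>

lemma connected_complement_initial_segment:
  assumes m: "m < 2 ^ n"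
  shows "connected_graph (induced (enhanced_hypercube n) ({x. length x = n} - initial_segment n m))"
    (is "connected_graph ?G")
proof (rule connected_graphI[where f = "\<lambda>x. 2 ^ n - val x" and r = "replicate n True"])
  show "replicate n True \<in> verts ?G"
    using m by (simp add: induced_def initial_segment_def)
  fix x assume "x \<in> verts ?G" "x \<noteq> replicate n True"
  then have x: "length x = n" "m \<le> val x" "x \<noteq> replicate n True"
    by (auto simp: induced_def initial_segment_def)
  then obtain i where i: "i < n" "\<not> x ! i" by (metis (full_types) in_set_conv_nth replicate_eqI)
  have v: "val x < val (flip i x)" using val_flip[of i x] i x by simp
  have "val (flip i x) < 2 ^ n" using val_less[of "flip i x"] x by simp
  then have v': "2 ^ n - val (flip i x) < 2 ^ n - val x" using v by linarith
  have "{x, flip i x} \<in> edges (enhanced_hypercube n)"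
    using i x by (subst edge_enhanced_iff) (auto simp: nbr_def intro!: exI[of _ i])
  then show "\<exists>y\<in>verts ?G. {x, y} \<in> edges ?G \<and> 2 ^ n - val y < 2 ^ n - val x"
    using x v v' by (intro bexI[of _ "flip i x"]) (auto simp: induced_def initial_segment_def)
qed

text \<open>Together the two sums contain each power from \<open>2 ^ k\<close> down to
  \<open>2 ^ (k - 2 * j)\<close> once; the extra copy of the last one completes them to
  \<open>2 ^ (k + 1)\<close>.\<close>

lemma telescoping_power2:
  "2 * j \<le> k \<Longrightarrow>
    (\<Sum>i<j. 2 ^ (k - 1 - 2 * i)) + 2 ^ (k - 2 * j) + (\<Sum>i\<le>j. 2 ^ (k - 2 * i)) = (2 * 2 ^ k :: nat)"
proof (induction j)
  case (Suc j)
  then obtain l where "k = 2 * j + 2 + l" by (metis add.commute le_Suc_ex mult_Suc_right)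
  then show ?case using Suc by simp
qed simp

lemma m_val_iff_extremal:
  assumes n: "9 \<le> n"
  shows "(\<exists>r. 1 \<le> r \<and> r \<le> nat \<lceil>real n / 2\<rceil> - 1 \<and> h = m_val n r) \<longleftrightarrow> h \<in> extremal_sizes (n - 1)"
proof -
  define c f where "c = nat \<lceil>real n / 2\<rceil>" and "f = (if even n then 0 else 1 :: nat)"
  obtain k where k: "n = k + 7" using n by (intro that[of "n - 7"]) simp
  \<comment> \<open>This removes the ceiling, and makes the exponent \<open>2 * r - 1 - f\<close>
    equal to \<open>k - 2 * j\<close> for \<open>r = c - 3 - j\<close>.\<close>
  have c: "n + f = 2 * c"
  proof (cases "even n")
    case True
    then show ?thesis by (auto simp: c_def f_def elim!: evenE)
  next
    case False
    then obtain q where q: "n = 2 * q + 1" by (auto elim: oddE)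
    have "\<lceil>real n / 2\<rceil> = int q + 1" unfolding q by (rule ceiling_unique) auto
    then show ?thesis using False q by (simp add: c_def f_def nat_add_distrib)
  qed
  have f: "f \<le> 1" by (simp add: f_def)
  have c5: "5 \<le> c" using c n f by linarith
  have sets: "{0..2} = {0, 1, 2 :: nat}" "{0..3} = {0, 1, 2, 3 :: nat}" by auto
  \<comment> \<open>The first three powers leave \<open>2 ^ (k + 1)\<close> to
    \<open>2 ^ (k + 4)\<close>, which \<open>telescoping_power2\<close> fills; \<open>j = 0\<close>
    is the separate branch \<open>r = c - 3\<close>.\<close>
  have val: "m_val n (c - 3 - j) + (\<Sum>i\<le>j. 2 ^ (k - 2 * i)) = 2 ^ (k + 4)" if j: "j + 4 \<le> c" for j
  proof (cases j)
    case 0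
    have "m_val n (c - 3) = (\<Sum>i = 0..3. 2 ^ (n - 4 - i))"
      unfolding m_val_def Let_def c_def[symmetric] using c5 by auto
    then show ?thesis using 0 by (simp add: k sets power_add)
  next
    case (Suc i)
    have e: "n - 8 = k - 1" "c - 4 - (c - 3 - j) = i" "2 * (c - 3 - j) - 1 - f = k - 2 * j" "c - 3 - j \<le> c - 4"
      using c f j k Suc by auto
    have "m_val n (c - 3 - j) =
      (\<Sum>i = 0..2. 2 ^ (n - 4 - i)) + (\<Sum>i<j. 2 ^ (k - 1 - 2 * i)) + 2 ^ (k - 2 * j)"
      unfolding m_val_def Let_def c_def[symmetric] f_def[symmetric] e
      using e(4) Suc by (simp add: atLeast0AtMost lessThan_Suc_atMost)
    moreover have "2 * j \<le> k" using c f j k by linarith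
    ultimately show ?thesis
      using telescoping_power2[of j k] by (simp add: k sets power_add)
  qed
  have val': "m_val n (c - 2) = 2 ^ (n - 3)" "m_val n (c - 1) = 2 ^ (n - 1)"
    unfolding m_val_def Let_def c_def[symmetric] using c5 by auto
  \<comment> \<open>Since \<open>2 * c = k + 7 + f\<close>, the right side says
    \<open>2 * j + 1 \<le> k + f\<close>; the parity of \<open>k\<close> makes this the left
    side.\<close>
  have jk: "2 * j \<le> k \<longleftrightarrow> j + 4 \<le> c" for j
    using c f unfolding k by presburger
  have ext: "h \<in> extremal_sizes (n - 1) \<longleftrightarrow>
    h = 2 ^ (n - 1) \<or> h = 2 ^ (n - 3) \<or> (\<exists>j. 2 * j \<le> k \<and> h + (\<Sum>i\<le>j. 2 ^ (k - 2 * i)) = 2 ^ (k + 4))"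
    by (auto simp: extremal_sizes_def k)
  show ?thesis unfolding c_def[symmetric] ext jk
  proof
    assume "\<exists>r. 1 \<le> r \<and> r \<le> c - 1 \<and> h = m_val n r"
    then obtain r where r: "1 \<le> r" "r \<le> c - 1" "h = m_val n r" by blast
    consider "r = c - 1" | "r = c - 2" | "r \<le> c - 3" using r by linarith
    then show "h = 2 ^ (n - 1) \<or> h = 2 ^ (n - 3) \<or> (\<exists>j. j + 4 \<le> c \<and> h + (\<Sum>i\<le>j. 2 ^ (k - 2 * i)) = 2 ^ (k + 4))"
    proof cases
      case 3
      then have "c - 3 - r + 4 \<le> c" "c - 3 - (c - 3 - r) = r" using r c5 by auto
      then show ?thesis using val[of "c - 3 - r"] r by auto
    qed (use val' r in auto)
  next
    assume "h = 2 ^ (n - 1) \<or> h = 2 ^ (n - 3) \<or> (\<exists>j. j + 4 \<le> c \<and> h + (\<Sum>i\<le>j. 2 ^ (k - 2 * i)) = 2 ^ (k + 4))"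
    then consider "h = m_val n (c - 1)" | "h = m_val n (c - 2)"
      | j where "j + 4 \<le> c" "h = m_val n (c - 3 - j)" using val val' by (metis add_right_cancel)
    then show "\<exists>r. 1 \<le> r \<and> r \<le> c - 1 \<and> h = m_val n r"
    proof cases
      case 1
      then show ?thesis using c5 by (intro exI[of _ "c - 1"]) auto
    next
      case 2
      then show ?thesis using c5 by (intro exI[of _ "c - 2"]) auto
    next
      case 3
      then show ?thesis using c5 by (intro exI[of _ "c - 3 - j"]) auto
    qed
  qed
qed

section \<open>From the boundary bound to \<lambda>_h and \<xi>_m\<close>

theorem theorem1p1:
  fixes n h :: nat
  assumes "9 \<le> n"
    and "\<lceil>11 * 2 ^ (n - 1) / (48 :: real)\<rceil> \<le> int h"
    and "h \<le> 2 ^ (n - 1)"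
  shows "(extra_edge_conn h (enhanced_hypercube n) = xi (2 ^ (n - 1)) (enhanced_hypercube n) \<and>
          xi (2 ^ (n - 1)) (enhanced_hypercube n) = enat (2 ^ (n - 1))) \<and>
         (extra_optimal h (enhanced_hypercube n) \<longleftrightarrow>
            extra_edge_conn h (enhanced_hypercube n) = xi h (enhanced_hypercube n) \<and>
            xi h (enhanced_hypercube n) = enat (2 ^ (n - 1))) \<and>
         (extra_optimal h (enhanced_hypercube n) \<longleftrightarrow>
            (\<exists>r. 1 \<le> r \<and> r \<le> nat \<lceil>real n / 2\<rceil> - 1 \<and> h = m_val n r))"
proof -
  define G where "G = enhanced_hypercube n"
  define bd where "bd X = card (edges_between G X (verts G - X))" for X
  obtain k where k: "n = Suc k" "8 \<le> k" using assms(1) by (cases n) auto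
  have V: "verts G = {x. length x = n}" by (simp add: G_def)
  have cV: "card (verts G) = 2 * 2 ^ k" by (simp add: V card_strings k)
  have h: "11 * 2 ^ k \<le> 48 * h" "h \<le> 2 ^ k"
  proof -
    have "11 * 2 ^ k / (48 :: real) \<le> real h" using assms(2) k by (simp add: ceiling_le_iff)
    then have "real (11 * 2 ^ k) \<le> real (48 * h)" by simp
    then show "11 * 2 ^ k \<le> 48 * h" by (simp only: of_nat_le_iff)
  qed (use assms k in simp)
  have bd: "bd X + enh_deg (Suc k) X = (k + 2) * card X" if "X \<subseteq> verts G" for X
    using card_edges_between_enhanced[of n X] that k by (simp add: bd_def G_def)
  have lower: "2 ^ k \<le> bd X" "bd X = 2 ^ k \<Longrightarrow> card X \<in> extremal_sizes k"
    if "X \<subseteq> verts G" "11 * 2 ^ k \<le> 48 * card X" "card X \<le> 2 ^ k" for X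
    using enh_deg_le[of X k] that bd[OF that(1)] k V by auto
  have xi_ge: "enat (2 ^ k) \<le> xi m G" if "11 * 2 ^ k \<le> 48 * m" "m \<le> 2 ^ k" for m
    unfolding xi_def by (rule Inf_greatest) (use lower that in \<open>auto simp: bd_def\<close>)
  \<comment> \<open>Stated with one more edge, so that strictness survives the infimum.\<close>
  have xi_gt: "enat (2 ^ k + 1) \<le> xi m G"
    if m: "11 * 2 ^ k \<le> 48 * m" "m \<le> 2 ^ k" "m \<notin> extremal_sizes k" for m
    unfolding xi_def
  proof (rule Inf_greatest)
    fix z assume "z \<in> {enat (card (edges_between G X (verts G - X))) | X. X \<subseteq> verts G \<and> card X = m \<and>
      connected_graph (induced G X) \<and> connected_graph (induced G (verts G - X))}"
    then obtain X where "z = enat (bd X)" "X \<subseteq> verts G" "card X = m" by (auto simp: bd_def)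
    then show "enat (2 ^ k + 1) \<le> z" using lower[of X] m by fastforce
  qed
  have segment: "initial_segment n m \<subseteq> verts G" "card (initial_segment n m) = m"
    "connected_graph (induced G (initial_segment n m))"
    "connected_graph (induced G (verts G - initial_segment n m))"
    "bd (initial_segment n m) \<le> 2 ^ k" if m: "m \<in> extremal_sizes k" for m
  proof -
    have k6: "6 \<le> k" using k by simp
    note m' = cube_edges_extremal_sizes(2,3)[OF k6 m]
    have less: "m < 2 ^ n" using m' k by (simp add: order_le_less_trans[OF m'(2)])
    show sub: "initial_segment n m \<subseteq> verts G" unfolding V by (rule initial_segment_subset)
    show c: "card (initial_segment n m) = m" using less by (simp add: card_initial_segment)
    show "connected_graph (induced G (initial_segment n m))"
      unfolding G_def by (rule connected_initial_segment[OF m'(1)])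
    show "connected_graph (induced G (verts G - initial_segment n m))"
      unfolding V unfolding G_def by (rule connected_complement_initial_segment[OF less])
    show "bd (initial_segment n m) \<le> 2 ^ k"
      using enh_deg_initial_segment[OF k6 m] bd[OF sub] c k by simp
  qed
  have xi_le: "xi m G \<le> enat (2 ^ k)" if "m \<in> extremal_sizes k" for m
  proof -
    have "xi m G \<le> enat (bd (initial_segment n m))"
      unfolding xi_def bd_def using segment[OF that] by (intro Inf_lower) auto
    then show ?thesis using segment(5)[OF that] by (meson enat_ord_simps(1) order_trans)
  qed
  have half: "2 ^ k \<in> extremal_sizes k" by (simp add: extremal_sizes_def)
  have xi_half: "xi (2 ^ k) G = enat (2 ^ k)"
    using xi_le[OF half] xi_ge[of "2 ^ k"] by (simp add: order_antisym)
  have conn: "extra_edge_conn h G = enat (2 ^ k)"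
  proof (rule order_antisym)
    \<comment> \<open>Cutting along the facet \<open>x_n = 0\<close> leaves \<open>2 ^ k\<close>
      vertices on either side, which is admissible for every \<open>h\<close> in the range.\<close>
    let ?X = "initial_segment n (2 ^ k)"
    have "card (verts G - ?X) = 2 ^ k"
      using segment(1,2)[OF half] cV by (simp add: card_Diff_subset finite_subset V)
    then have "extra_edge_cut h G (edges_between G ?X (verts G - ?X))"
      using segment[OF half] h by (intro extra_edge_cut_edges_between) (auto simp: V)
    then have "extra_edge_conn h G \<le> enat (bd ?X)"
      unfolding extra_edge_conn_def bd_def by (intro Inf_lower) auto
    then show "extra_edge_conn h G \<le> enat (2 ^ k)"
      using segment(5)[OF half] by (meson enat_ord_simps(1) order_trans)
    show "enat (2 ^ k) \<le> extra_edge_conn h G"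
      unfolding extra_edge_conn_def
    proof (rule Inf_greatest)
      fix z assume "z \<in> {enat (card F) | F. extra_edge_cut h G F}"
      then obtain F where F: "z = enat (card F)" "extra_edge_cut h G F" by auto
      have ne: "verts G \<noteq> {}" using cV by auto
      obtain C where C: "C \<subseteq> verts G" "h \<le> card C" "2 * card C \<le> card (verts G)"
        "edges_between G C (verts G - C) \<subseteq> F"
        by (rule extra_edge_cut_small_component[OF _ ne F(2)]) (simp add: V)
      have "finite F"
        using F(2) finite_subset[OF _ finite_edges_enhanced] by (auto simp: extra_edge_cut_def G_def)
      then have "bd C \<le> card F" unfolding bd_def using C(4) by (rule card_mono)
      \<comment> \<open>The small component has between \<open>h\<close> and \<open>2 ^ k\<close>
        vertices, exactly the range of the boundary bound.\<close>
      moreover have "2 ^ k \<le> bd C" using C h cV by (intro lower) auto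
      ultimately show "enat (2 ^ k) \<le> z" using F by simp
    qed
  qed
  have opt: "extra_optimal h G \<longleftrightarrow> xi h G = enat (2 ^ k)"
    unfolding extra_optimal_def conn by auto
  have "xi h G = enat (2 ^ k) \<longleftrightarrow> h \<in> extremal_sizes k"
  proof
    assume "xi h G = enat (2 ^ k)"
    then show "h \<in> extremal_sizes k" using xi_gt[OF h] by (cases "h \<in> extremal_sizes k") auto
  next
    assume "h \<in> extremal_sizes k"
    then show "xi h G = enat (2 ^ k)" using xi_le xi_ge[OF h] by (simp add: order_antisym)
  qed
  moreover have "n - 1 = k" using k by simp
  ultimately show ?thesis
    using conn xi_half opt m_val_iff_extremal[OF assms(1), of h] unfolding G_def[symmetric] by metis
qed

end
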